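(* Let $A$ be a complex $m\times n$ matrix. If $A$ is real, then $$\sigma_1(A)\le 2\sqrt{|A|_\infty\,\|A\|_\square\, mn};\qquad(1)$$ if $A$ is complex, then $$\sigma_1(A)\le 4\sqrt{|A|_\infty\,\|A\|_\square\, mn}\qquad(2)$$ and $$\sigma_1(A)\le C\,\|A\|_{\boxdot}\sqrt{\log m\,\log n}\qquad(3)$$ for some positive constant $C<10^5$. Inequalities (1), (2) and (3) are tight up to constant factors.
   Context: For a complex $m\times n$ matrix $A=[a_{ij}]$: $\sigma_1(A)$ is the largest singular value of $A$; $|A|_\infty=\max_{i,j}|a_{ij}|$; for $X\subset[m]=\{1,\dots,m\}$ and $Y\subset[n]=\{1,\dots,n\}$, $A[X,Y]$ is the submatrix of all $a_{ij}$ with $i\in X$, $j\in Y$; $\Sigma(M)$ is the sum of the entries of a matrix $M$ (zero if the matrix is empty). The cut-norm is $$\|A\|_\square=\max_{X\subset[m],\,Y\subset[n]}\frac1{mn}\left|\Sigma(A[X,Y])\right|,$$ and the norm $\|A\|_{\boxdot}$ is $$\|A\|_{\boxdot}=\max_{X\subset[m],\ Y\subset[n],\ X,Y\neq\varnothing}\frac{1}{\sqrt{|X||Y|}}\left|\Sigma(A[X,Y])\right|.$$ $\log$ denotes the natural logarithm.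
   Formalization: Inequality (3) and its tightness are stated for m, n ≥ 2 only: if m = 1 or n = 1 then log 1 = 0 makes the right side zero, while σ₁(A) > 0 for every nonzero A, so (3) fails there. *)

theory Defs
  imports
    Complex_Main
    "Jordan_Normal_Form.Matrix"
    "Jordan_Normal_Form.Char_Poly"
    "Jordan_Normal_Form.Schur_Decomposition"
    "Jordan_Normal_Form.DL_Submatrix"
begin

text \<open>Rows and columns are indexed from 0, so the index sets are \<open>{..<m}\<close> and \<open>{..<n}\<close>.
  All maxima below are taken over finite nonempty sets provided that \<open>m, n \<ge> 1\<close>.\<close>

text \<open>The eigenvalues of \<open>A\<^sup>* A\<close> are real and nonnegative; the singular values of \<open>A\<close> are their
  nonnegative square roots.\<close>

definition singular_values :: "complex mat \<Rightarrow> real set" where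
  "singular_values A = {s. 0 \<le> s \<and> eigenvalue (mat_adjoint A * A) (complex_of_real (s\<^sup>2))}"

definition sigma1 :: "complex mat \<Rightarrow> real" where
  "sigma1 A = Max (singular_values A)"

definition max_entry :: "complex mat \<Rightarrow> real" where
  "max_entry A = Max (cmod ` elements_mat A)"

definition entry_sum :: "complex mat \<Rightarrow> complex" where
  "entry_sum M = (\<Sum>i<dim_row M. \<Sum>j<dim_col M. M $$ (i, j))"

definition cut_norm :: "complex mat \<Rightarrow> real" where
  "cut_norm A = Max {1 / (real (dim_row A) * real (dim_col A)) * cmod (entry_sum (submatrix A X Y)) | X Y.
     X \<subseteq> {..<dim_row A} \<and> Y \<subseteq> {..<dim_col A}}"

definition boxdot_norm :: "complex mat \<Rightarrow> real" where
  "boxdot_norm A = Max {1 / sqrt (real (card X) * real (card Y)) * cmod (entry_sum (submatrix A X Y)) | X Y.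
     X \<subseteq> {..<dim_row A} \<and> Y \<subseteq> {..<dim_col A} \<and> X \<noteq> {} \<and> Y \<noteq> {}}"

end

theory Submission
  imports Defs "Jordan_Normal_Form.Spectral_Radius" "HOL-Analysis.L2_Norm"
begin

text \<open>
  \<^bold>\<open>Cut-norm.\<close> Let \<open>v\<close> be an eigenvector of \<open>A\<^sup>* A\<close> for the largest singular value \<open>\<sigma>\<close>. Reading the
  eigenvalue equation in a coordinate \<open>j\<close> where \<open>|v\<^sub>j|\<close> is largest gives
  \<open>\<sigma>\<^sup>2 \<le> \<Sum>\<^sub>k |(A\<^sup>* A)\<^sub>j\<^sub>k|\<close>. The absolute values are removed by numbers \<open>e\<^sub>k\<close> of modulus at most \<open>1\<close>;
  then the bound becomes \<open>|A|\<^sub>\<infinity> \<Sum>\<^sub>i |\<Sum>\<^sub>k a\<^sub>i\<^sub>k e\<^sub>k|\<close>, and a second choice \<open>d\<^sub>i\<close> turns the sum into the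
  bilinear form \<open>\<Sum>\<^sub>i\<^sub>k d\<^sub>i a\<^sub>i\<^sub>k e\<^sub>k\<close> (\<open>sigma1_sq_le_max_entry_mult\<close>). Such a form is at most \<open>mn\<close> times the
  cut-norm if its arguments lie in \<open>[0, 1]\<close>, since a convex function on a cube is maximal at a vertex.
  A real argument in \<open>[-1, 1]\<close> is a difference of two such arguments and a complex one is a combination
  of four; with two arguments this costs a factor \<open>4\<close> or \<open>16\<close>, whose square root is the constant \<open>2\<close>
  or \<open>4\<close>. If \<open>A\<close> is real, then the \<open>e\<^sub>k\<close> and \<open>d\<^sub>i\<close> can be taken real, whatever \<open>v\<close> is.

  \<^bold>\<open>Box-dot norm.\<close> With \<open>u = A v\<close> we have \<open>\<parallel>u\<parallel> = \<sigma> \<parallel>v\<parallel>\<close> and \<open>\<parallel>u\<parallel>\<^sup>2 = \<Sum>\<^sub>i\<^sub>j u\<^sub>i\<^sup>* a\<^sub>i\<^sub>j v\<^sub>j\<close>, so it is enough to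
  bound this form by a multiple of \<open>\<parallel>u\<parallel> \<parallel>v\<parallel>\<close>. Suppose that a linear form is at most \<open>B \<surd>|X|\<close> on the
  indicator vector of every set \<open>X\<close>, and let \<open>x\<close> have the nonnegative decreasing entries
  \<open>x\<^sub>1, ..., x\<^sub>k\<close>. Writing \<open>x\<close> as a combination of the indicators of \<open>{1..l}\<close> with coefficients
  \<open>x\<^sub>l - x\<^sub>l\<^sub>+\<^sub>1\<close> and summing by parts bounds the form by \<open>B \<Sum>\<^sub>l x\<^sub>l (\<surd>l - \<surd>(l-1)) \<le> B \<Sum>\<^sub>l x\<^sub>l / \<surd>l\<close>,
  which by Cauchy-Schwarz is at most \<open>B \<parallel>x\<parallel>\<close> times the square root of a harmonic number
  (\<open>norm_combination_le_harmonic\<close>). Applied to rows and then to columns this yields the two factors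
  \<open>\<surd>log m\<close> and \<open>\<surd>log n\<close>; splitting \<open>u\<close> and \<open>v\<close> into four nonnegative parts each costs \<open>16\<close>, and
  passing from harmonic numbers to logarithms costs \<open>3\<close>, so that \<open>C = 48\<close> suffices.

  \<^bold>\<open>Tightness.\<close> Both witnesses have rank one, so their singular value is explicit. For the cut-norm
  it is the all-ones matrix. For the box-dot norm it is the matrix with entries \<open>1 / \<surd>(ij)\<close>, the
  equality case of the Cauchy-Schwarz step above: its box-dot norm is at most \<open>4\<close>, and
  \<open>\<sigma>\<^sub>1 = \<surd>(H\<^sub>m H\<^sub>n)\<close> with the harmonic numbers \<open>H\<close>.
\<close>

section \<open>Singular values in coordinates\<close>

lemma singular_valueI:
  "\<lbrakk>eigenvalue (mat_adjoint A * A) (complex_of_real (s\<^sup>2)); 0 \<le> s\<rbrakk> \<Longrightarrow> s \<in> singular_values A"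
  by (simp add: singular_values_def)

lemma gram_index:
  fixes A :: "complex mat"
  assumes A: "A \<in> carrier_mat m n"
  shows "mat_adjoint A * A \<in> carrier_mat n n"
    and "\<lbrakk>j < n; k < n\<rbrakk> \<Longrightarrow>
      (mat_adjoint A * A) $$ (j, k) = (\<Sum>i<m. cnj (A $$ (i, j)) * A $$ (i, k))"
proof -
  have ad: "mat_adjoint A \<in> carrier_mat n m"
    using A unfolding mat_adjoint_def by auto
  then show "mat_adjoint A * A \<in> carrier_mat n n" using A by auto
  assume jk: "j < n" "k < n"
  have "row (mat_adjoint A) j = conjugate (col A j)"
    using A jk unfolding mat_adjoint_def by (subst mat_of_rows_row) auto
  then show "(mat_adjoint A * A) $$ (j, k) = (\<Sum>i<m. cnj (A $$ (i, j)) * A $$ (i, k))"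
    using A ad jk by (auto simp: scalar_prod_def lessThan_atLeast0 intro!: sum.cong)
qed

lemma eigenvalue_gram_iff:
  fixes A :: "complex mat"
  assumes A: "A \<in> carrier_mat m n"
  shows "eigenvalue (mat_adjoint A * A) l \<longleftrightarrow>
    (\<exists>v. (\<exists>j<n. v j \<noteq> 0) \<and>
      (\<forall>j<n. (\<Sum>k<n. (\<Sum>i<m. cnj (A $$ (i, j)) * A $$ (i, k)) * v k) = l * v j))"
    (is "?L \<longleftrightarrow> ?R")
proof
  have G: "mat_adjoint A * A \<in> carrier_mat n n" by (rule gram_index(1)[OF A])
  have mv: "((mat_adjoint A * A) *\<^sub>v w) $ j =
      (\<Sum>k<n. (\<Sum>i<m. cnj (A $$ (i, j)) * A $$ (i, k)) * w $ k)"
    if "w \<in> carrier_vec n" "j < n" for w j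
  proof -
    have "(B *\<^sub>v w) $ j = (\<Sum>k<n. B $$ (j, k) * w $ k)" if "B \<in> carrier_mat n n" for B
      using that \<open>w \<in> carrier_vec n\<close> \<open>j < n\<close> by (simp add: scalar_prod_def lessThan_atLeast0)
    from this[OF G] have "((mat_adjoint A * A) *\<^sub>v w) $ j =
      (\<Sum>k<n. (mat_adjoint A * A) $$ (j, k) * w $ k)" .
    then show ?thesis using gram_index(2)[OF A that(2)] by simp
  qed
  show ?R if ?L
  proof -
    obtain w where w: "w \<in> carrier_vec n" "w \<noteq> 0\<^sub>v n"
      "(mat_adjoint A * A) *\<^sub>v w = l \<cdot>\<^sub>v w"
      using \<open>?L\<close> G unfolding eigenvalue_def eigenvector_def by auto
    have "\<exists>j<n. w $ j \<noteq> 0" using w(1,2) by (auto intro!: eq_vecI)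
    moreover have "(\<Sum>k<n. (\<Sum>i<m. cnj (A $$ (i, j)) * A $$ (i, k)) * w $ k) = l * w $ j"
      if "j < n" for j
      using mv[OF w(1) that] w that by simp
    ultimately show ?R by (intro exI[of _ "\<lambda>j. w $ j"]) auto
  qed
  show ?L if ?R
  proof -
    obtain v j0 where v: "j0 < n" "v j0 \<noteq> 0"
      "\<And>j. j < n \<Longrightarrow> (\<Sum>k<n. (\<Sum>i<m. cnj (A $$ (i, j)) * A $$ (i, k)) * v k) = l * v j"
      using \<open>?R\<close> by blast
    have "vec n v \<noteq> 0\<^sub>v n"
    proof
      assume "vec n v = 0\<^sub>v n"
      then have "vec n v $ j0 = 0\<^sub>v n $ j0" by simp
      then show False using v by simp
    qed
    moreover have "(mat_adjoint A * A) *\<^sub>v vec n v = l \<cdot>\<^sub>v vec n v"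
    proof (rule eq_vecI)
      show "((mat_adjoint A * A) *\<^sub>v vec n v) $ j = (l \<cdot>\<^sub>v vec n v) $ j"
        if "j < dim_vec (l \<cdot>\<^sub>v vec n v)" for j
        using that mv[of "vec n v" j] v(3)[of j] by simp
    qed (use G in auto)
    ultimately show ?L
      using G unfolding eigenvalue_def eigenvector_def by (intro exI[of _ "vec n v"]) auto
  qed
qed

text \<open>This is \<open>v\<^sup>* A\<^sup>* A v = (A v)\<^sup>* (A v)\<close> for an eigenvector \<open>v\<close> of \<open>A\<^sup>* A\<close> with eigenvalue \<open>l\<close>.\<close>

lemma norm_sq_image_eigenvector:
  fixes A :: "complex mat"
  assumes v: "\<And>j. j < n \<Longrightarrow>
    (\<Sum>k<n. (\<Sum>i<m. cnj (A $$ (i, j)) * A $$ (i, k)) * v k) = l * v j"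
  shows "of_real (\<Sum>i<m. (cmod (\<Sum>k<n. A $$ (i, k) * v k))\<^sup>2) = l * of_real (\<Sum>j<n. (cmod (v j))\<^sup>2)"
proof -
  have "complex_of_real (\<Sum>i<m. (cmod (\<Sum>k<n. A $$ (i, k) * v k))\<^sup>2) =
      (\<Sum>i<m. cnj (\<Sum>j<n. A $$ (i, j) * v j) * (\<Sum>k<n. A $$ (i, k) * v k))"
    unfolding of_real_sum by (simp only: complex_norm_square mult.commute)
  also have "\<dots> = (\<Sum>i<m. \<Sum>j<n. \<Sum>k<n. cnj (v j) * (cnj (A $$ (i, j)) * A $$ (i, k) * v k))"
    unfolding cnj_sum sum_product by (simp add: mult_ac)
  also have "\<dots> = (\<Sum>j<n. \<Sum>i<m. \<Sum>k<n. cnj (v j) * (cnj (A $$ (i, j)) * A $$ (i, k) * v k))"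
    by (rule sum.swap)
  also have "\<dots> = (\<Sum>j<n. \<Sum>k<n. \<Sum>i<m. cnj (v j) * (cnj (A $$ (i, j)) * A $$ (i, k) * v k))"
    by (intro sum.cong refl sum.swap)
  also have "\<dots> = (\<Sum>j<n. cnj (v j) *
      (\<Sum>k<n. (\<Sum>i<m. cnj (A $$ (i, j)) * A $$ (i, k)) * v k))"
    by (simp add: sum_distrib_left sum_distrib_right mult_ac)
  also have "\<dots> = (\<Sum>j<n. cnj (v j) * (l * v j))"
    using v by (intro sum.cong) auto
  also have "\<dots> = l * of_real (\<Sum>j<n. (cmod (v j))\<^sup>2)"
    unfolding of_real_sum sum_distrib_left
    by (intro sum.cong refl) (simp add: complex_norm_square[symmetric] mult_ac del: of_real_power flip: complex_norm_square)
  finally show ?thesis .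
qed

lemma finite_singular_values:
  assumes A: "A \<in> carrier_mat m n"
  shows "finite (singular_values A)"
proof -
  have "inj_on (\<lambda>s. complex_of_real (s\<^sup>2)) (singular_values A)"
  proof (rule inj_onI)
    fix s t assume "s \<in> singular_values A" "t \<in> singular_values A"
      and eq: "complex_of_real (s\<^sup>2) = complex_of_real (t\<^sup>2)"
    then have "0 \<le> s" "0 \<le> t" by (auto simp: singular_values_def)
    moreover have "s\<^sup>2 = t\<^sup>2" using eq unfolding of_real_eq_iff .
    ultimately show "s = t" by simp
  qed
  moreover have "(\<lambda>s. complex_of_real (s\<^sup>2)) ` singular_values A \<subseteq> spectrum (mat_adjoint A * A)"
    by (auto simp: singular_values_def spectrum_def)
  moreover have "finite (spectrum (mat_adjoint A * A))"
    by (rule card_finite_spectrum(1)[OF gram_index(1)[OF A]])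
  ultimately show ?thesis by (meson finite_imageD finite_subset)
qed

text \<open>By the identity \<open>\<parallel>A v\<parallel>\<^sup>2 = \<lambda> \<parallel>v\<parallel>\<^sup>2\<close> every eigenvalue \<open>\<lambda>\<close> of \<open>A\<^sup>* A\<close> is a nonnegative real, so
  it has a square root among the singular values.\<close>

lemma singular_values_nonempty:
  assumes A: "A \<in> carrier_mat m n" and n: "1 \<le> n"
  shows "singular_values A \<noteq> {}"
proof -
  obtain l where l: "eigenvalue (mat_adjoint A * A) l"
    using spectrum_non_empty[OF gram_index(1)[OF A]] n by (auto simp: spectrum_def)
  then obtain v j0 where j0: "j0 < n" "v j0 \<noteq> 0" and
    v: "\<And>j. j < n \<Longrightarrow> (\<Sum>k<n. (\<Sum>i<m. cnj (A $$ (i, j)) * A $$ (i, k)) * v k) = l * v j"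
    unfolding eigenvalue_gram_iff[OF A] by blast
  define p q where "p = (\<Sum>i<m. (cmod (\<Sum>k<n. A $$ (i, k) * v k))\<^sup>2)" and "q = (\<Sum>j<n. (cmod (v j))\<^sup>2)"
  have "0 < q" unfolding q_def using j0 by (intro sum_pos2[of _ j0]) auto
  have "0 \<le> p" unfolding p_def by (intro sum_nonneg) auto
  have "of_real p = l * of_real q"
    unfolding p_def q_def by (rule norm_sq_image_eigenvector[OF v])
  then have "l = of_real (p / q)" using \<open>0 < q\<close> by (simp add: field_simps)
  also have "p / q = (sqrt (p / q))\<^sup>2" using \<open>0 \<le> p\<close> \<open>0 < q\<close> by simp
  finally have l_eq: "l = of_real ((sqrt (p / q))\<^sup>2)" .
  have "eigenvalue (mat_adjoint A * A) (of_real ((sqrt (p / q))\<^sup>2))"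
    using l unfolding l_eq .
  then have "sqrt (p / q) \<in> singular_values A"
    by (rule singular_valueI) (use \<open>0 \<le> p\<close> \<open>0 < q\<close> in simp)
  then show ?thesis by blast
qed

text \<open>Since a maximum over the empty set would be an unspecified number, an eigenvector for
  \<open>sigma1 A\<close> exists only because the set of singular values is finite and nonempty.\<close>

lemma sigma1_eigenvector:
  assumes A: "A \<in> carrier_mat m n" and n: "1 \<le> n"
  obtains v where "0 \<le> sigma1 A" "\<exists>j<n. v j \<noteq> 0"
    "\<And>j. j < n \<Longrightarrow> (\<Sum>k<n. (\<Sum>i<m. cnj (A $$ (i, j)) * A $$ (i, k)) * v k) =
      complex_of_real ((sigma1 A)\<^sup>2) * v j"
proof -
  have "sigma1 A \<in> singular_values A"
    unfolding sigma1_def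
    by (rule Max_in[OF finite_singular_values[OF A] singular_values_nonempty[OF A n]])
  then have "0 \<le> sigma1 A" "eigenvalue (mat_adjoint A * A) (complex_of_real ((sigma1 A)\<^sup>2))"
    by (auto simp: singular_values_def)
  then show thesis using that unfolding eigenvalue_gram_iff[OF A] by blast
qed

text \<open>For the rank-one matrix \<open>a b\<^sup>T\<close> we have \<open>A\<^sup>* A = \<parallel>a\<parallel>\<^sup>2 b b\<^sup>T\<close>, which has the eigenvector \<open>b\<close>.\<close>

lemma sigma1_rank_one_ge:
  fixes a b :: "nat \<Rightarrow> real"
  assumes b: "\<exists>j<n. b j \<noteq> 0"
  shows "sqrt ((\<Sum>i<m. (a i)\<^sup>2) * (\<Sum>j<n. (b j)\<^sup>2)) \<le> sigma1 (mat m n (\<lambda>(i, j). complex_of_real (a i * b j)))"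
    (is "?s \<le> sigma1 ?A")
proof -
  have A: "?A \<in> carrier_mat m n" by simp
  have nn: "0 \<le> (\<Sum>i<m. (a i)\<^sup>2) * (\<Sum>j<n. (b j)\<^sup>2)"
    by (intro mult_nonneg_nonneg sum_nonneg) auto
  have "(\<Sum>k<n. (\<Sum>i<m. cnj (?A $$ (i, j)) * ?A $$ (i, k)) * complex_of_real (b k)) =
      complex_of_real (?s\<^sup>2) * complex_of_real (b j)" if "j < n" for j
  proof -
    have "(\<Sum>k<n. (\<Sum>i<m. cnj (?A $$ (i, j)) * ?A $$ (i, k)) * complex_of_real (b k)) =
      complex_of_real (\<Sum>k<n. (\<Sum>i<m. (a i * b j) * (a i * b k)) * b k)"
      using that by (simp add: sum_distrib_right)
    also have "(\<Sum>k<n. (\<Sum>i<m. (a i * b j) * (a i * b k)) * b k) =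
        (\<Sum>k<n. ((\<Sum>i<m. (a i)\<^sup>2) * b j) * (b k)\<^sup>2)"
      by (intro sum.cong refl) (simp add: sum_distrib_right sum_distrib_left power2_eq_square mult_ac)
    also have "\<dots> = ?s\<^sup>2 * b j"
      using nn by (simp add: sum_distrib_left mult_ac)
    finally show ?thesis by simp
  qed
  moreover have "\<exists>j<n. complex_of_real (b j) \<noteq> 0" using b by simp
  ultimately have "eigenvalue (mat_adjoint ?A * ?A) (complex_of_real (?s\<^sup>2))"
    unfolding eigenvalue_gram_iff[OF A] by (intro exI[of _ "\<lambda>j. complex_of_real (b j)"]) blast
  then have "?s \<in> singular_values ?A" by (rule singular_valueI) (use nn in simp)
  then show ?thesis
    unfolding sigma1_def by (rule Max_ge[OF finite_singular_values[OF A]])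
qed

section \<open>The norms as maxima of sums over rectangles\<close>

text \<open>A submatrix renumbers the chosen rows and columns from 0; the sum of its entries can be taken
  over the original indices because \<open>pick\<close> enumerates the index sets bijectively.\<close>

lemma entry_sum_submatrix:
  assumes A: "A \<in> carrier_mat m n" and X: "X \<subseteq> {..<m}" and Y: "Y \<subseteq> {..<n}"
  shows "entry_sum (submatrix A X Y) = (\<Sum>i\<in>X. \<Sum>j\<in>Y. A $$ (i, j))"
proof -
  have pick: "bij_betw (pick S) {..<card S} S" if "finite S" for S
  proof -
    have "inj_on (pick S) {..<card S}"
      by (rule linorder_inj_onI) (use pick_mono_le in \<open>auto dest: less_imp_neq\<close>)
    moreover have "pick S ` {..<card S} \<subseteq> S" using pick_in_set_le by auto
    ultimately show ?thesis
      using that by (simp add: bij_betw_def card_image card_subset_eq)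
  qed
  have fin: "finite X" "finite Y" using X Y finite_subset by blast+
  have r: "{i. i < dim_row A \<and> i \<in> X} = X" and c: "{j. j < dim_col A \<and> j \<in> Y} = Y"
    using A X Y by auto
  have "entry_sum (submatrix A X Y) =
      (\<Sum>i<card X. \<Sum>j<card Y. A $$ (pick X i, pick Y j))"
    unfolding entry_sum_def dim_submatrix r c
    by (intro sum.cong refl) (simp add: submatrix_index r c)
  also have "\<dots> = (\<Sum>i<card X. \<Sum>j\<in>Y. A $$ (pick X i, j))"
    by (intro sum.cong refl sum.reindex_bij_betw pick fin)
  also have "\<dots> = (\<Sum>i\<in>X. \<Sum>j\<in>Y. A $$ (i, j))"
    by (rule sum.reindex_bij_betw[OF pick[OF fin(1)]])
  finally show ?thesis .
qed

lemma finite_rectangle_values: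
  "finite {f X Y | X Y. X \<subseteq> {..<m::nat} \<and> Y \<subseteq> {..<n::nat} \<and> P X Y}"
proof (rule finite_subset)
  show "{f X Y | X Y. X \<subseteq> {..<m} \<and> Y \<subseteq> {..<n} \<and> P X Y} \<subseteq>
      (\<lambda>(X, Y). f X Y) ` (Pow {..<m} \<times> Pow {..<n})" by auto
qed auto

lemma rectangle_sum_le_cut_norm:
  assumes A: "A \<in> carrier_mat m n" and m: "1 \<le> m" and n: "1 \<le> n"
    and X: "X \<subseteq> {..<m}" and Y: "Y \<subseteq> {..<n}"
  shows "cmod (\<Sum>i\<in>X. \<Sum>j\<in>Y. A $$ (i, j)) \<le> cut_norm A * real m * real n"
proof -
  have dim: "dim_row A = m" "dim_col A = n" using A by auto
  have "1 / (real m * real n) * cmod (entry_sum (submatrix A X Y)) \<le> cut_norm A"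
    unfolding cut_norm_def dim
    by (rule Max_ge) (use X Y finite_rectangle_values[where P = "\<lambda>_ _. True"] in auto)
  then show ?thesis
    using m n unfolding entry_sum_submatrix[OF A X Y] by (simp add: field_simps)
qed

lemma cut_norm_leI:
  assumes A: "A \<in> carrier_mat m n" and m: "1 \<le> m" and n: "1 \<le> n"
    and le: "\<And>X Y. \<lbrakk>X \<subseteq> {..<m}; Y \<subseteq> {..<n}\<rbrakk> \<Longrightarrow>
      cmod (\<Sum>i\<in>X. \<Sum>j\<in>Y. A $$ (i, j)) \<le> B * real m * real n"
  shows "cut_norm A \<le> B"
proof -
  have dim: "dim_row A = m" "dim_col A = n" using A by auto
  show ?thesis
    unfolding cut_norm_def dim
  proof (rule Max.boundedI)
    fix t assume "t \<in> {1 / (real m * real n) * cmod (entry_sum (submatrix A X Y)) |X Y.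
      X \<subseteq> {..<m} \<and> Y \<subseteq> {..<n}}"
    then obtain X Y where XY: "X \<subseteq> {..<m}" "Y \<subseteq> {..<n}"
      and t: "t = 1 / (real m * real n) * cmod (entry_sum (submatrix A X Y))" by blast
    show "t \<le> B"
      using le[OF XY] m n unfolding t entry_sum_submatrix[OF A XY] by (simp add: field_simps)
  qed (use finite_rectangle_values[where P = "\<lambda>_ _. True"] in auto)
qed

lemma rectangle_sum_le_boxdot_norm:
  assumes A: "A \<in> carrier_mat m n"
    and X: "X \<subseteq> {..<m}" and Y: "Y \<subseteq> {..<n}"
  shows "cmod (\<Sum>i\<in>X. \<Sum>j\<in>Y. A $$ (i, j)) \<le> boxdot_norm A * sqrt (real (card X)) * sqrt (real (card Y))"
proof (cases "X = {} \<or> Y = {}")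
  case False
  have dim: "dim_row A = m" "dim_col A = n" using A by auto
  have fin: "finite X" "finite Y" using X Y finite_subset by blast+
  have "1 / sqrt (real (card X) * real (card Y)) * cmod (entry_sum (submatrix A X Y)) \<le> boxdot_norm A"
    unfolding boxdot_norm_def dim
    by (rule Max_ge[OF finite_rectangle_values]) (use X Y False in blast)
  then show ?thesis
    using False fin unfolding entry_sum_submatrix[OF A X Y]
    by (simp add: field_simps real_sqrt_mult card_gt_0_iff)
qed auto

lemma boxdot_norm_leI:
  assumes A: "A \<in> carrier_mat m n" and m: "1 \<le> m" and n: "1 \<le> n"
    and le: "\<And>X Y. \<lbrakk>X \<subseteq> {..<m}; Y \<subseteq> {..<n}\<rbrakk> \<Longrightarrow>
      cmod (\<Sum>i\<in>X. \<Sum>j\<in>Y. A $$ (i, j)) \<le> B * sqrt (real (card X)) * sqrt (real (card Y))"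
  shows "boxdot_norm A \<le> B"
proof -
  have dim: "dim_row A = m" "dim_col A = n" using A by auto
  show ?thesis
    unfolding boxdot_norm_def dim
  proof (rule Max.boundedI)
    have "{0} \<subseteq> {..<m} \<and> {0} \<subseteq> {..<n} \<and> {0::nat} \<noteq> {} \<and> {0::nat} \<noteq> {}" using m n by auto
    then show "{1 / sqrt (real (card X) * real (card Y)) * cmod (entry_sum (submatrix A X Y)) |X Y.
      X \<subseteq> {..<m} \<and> Y \<subseteq> {..<n} \<and> X \<noteq> {} \<and> Y \<noteq> {}} \<noteq> {}" by blast
    fix t assume "t \<in> {1 / sqrt (real (card X) * real (card Y)) * cmod (entry_sum (submatrix A X Y)) |X Y.
      X \<subseteq> {..<m} \<and> Y \<subseteq> {..<n} \<and> X \<noteq> {} \<and> Y \<noteq> {}}"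
    then obtain X Y where XY: "X \<subseteq> {..<m}" "Y \<subseteq> {..<n}" and ne: "X \<noteq> {}" "Y \<noteq> {}"
      and t: "t = 1 / sqrt (real (card X) * real (card Y)) * cmod (entry_sum (submatrix A X Y))"
      by blast
    have "finite X" "finite Y" using XY finite_subset by blast+
    then show "t \<le> B"
      using le[OF XY] ne unfolding t entry_sum_submatrix[OF A XY]
      by (simp add: field_simps real_sqrt_mult card_gt_0_iff)
  qed (rule finite_rectangle_values)
qed

lemma finite_elements_mat: "finite (elements_mat A)"
proof -
  have "elements_mat A = (\<lambda>(i, j). A $$ (i, j)) ` ({..<dim_row A} \<times> {..<dim_col A})"
    unfolding elements_mat_def by fastforce
  then show ?thesis by simp
qed

lemma entry_le_max_entry:
  assumes "A \<in> carrier_mat m n" "i < m" "j < n"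
  shows "cmod (A $$ (i, j)) \<le> max_entry A"
  unfolding max_entry_def using assms finite_elements_mat[of A]
  by (intro Max_ge) auto

section \<open>From rectangles to bilinear forms\<close>

text \<open>Positive and negative parts reduce a real vector to two nonnegative vectors that it dominates;
  with real and imaginary parts, a complex vector is reduced to four. Formulated for all dominated
  vectors, the reduction serves the \<open>l\<^sup>\<infinity>\<close> bound for the cut-norm and the \<open>l\<^sup>2\<close> bound for the
  box-dot norm alike.\<close>

lemma norm_real_combination_le:
  fixes c :: "'a \<Rightarrow> complex" and x :: "'a \<Rightarrow> real"
  assumes le: "\<And>y. (\<And>i. i \<in> S \<Longrightarrow> 0 \<le> y i \<and> y i \<le> \<bar>x i\<bar>) \<Longrightarrow>
    cmod (\<Sum>i\<in>S. c i * of_real (y i)) \<le> B"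
  shows "cmod (\<Sum>i\<in>S. c i * of_real (x i)) \<le> 2 * B"
proof -
  let ?p = "\<Sum>i\<in>S. c i * of_real (max (x i) 0)" and ?q = "\<Sum>i\<in>S. c i * of_real (max (- x i) 0)"
  have "(\<Sum>i\<in>S. c i * of_real (x i)) = ?p - ?q"
    unfolding sum_subtractf[symmetric]
    by (intro sum.cong refl) (simp add: max_def)
  moreover have "cmod ?p \<le> B" "cmod ?q \<le> B"
    by (rule le; simp)+
  ultimately show ?thesis using norm_triangle_ineq4[of ?p ?q] by simp
qed

lemma norm_complex_combination_le:
  fixes c x :: "'a \<Rightarrow> complex"
  assumes le: "\<And>y. (\<And>i. i \<in> S \<Longrightarrow> 0 \<le> y i \<and> y i \<le> cmod (x i)) \<Longrightarrow>
    cmod (\<Sum>i\<in>S. c i * of_real (y i)) \<le> B"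
  shows "cmod (\<Sum>i\<in>S. c i * x i) \<le> 4 * B"
proof -
  let ?p = "\<Sum>i\<in>S. c i * of_real (Re (x i))" and ?q = "\<Sum>i\<in>S. c i * of_real (Im (x i))"
  have "(\<Sum>i\<in>S. c i * x i) = ?p + \<i> * ?q"
    unfolding sum_distrib_left sum.distrib[symmetric]
  proof (intro sum.cong refl)
    show "c i * x i = c i * of_real (Re (x i)) + \<i> * (c i * of_real (Im (x i)))" for i
      by (subst complex_eq[of "x i"]) (simp add: algebra_simps)
  qed
  moreover have "cmod ?p \<le> 2 * B"
    by (rule norm_real_combination_le, rule le) (meson abs_Re_le_cmod order_trans)
  moreover have "cmod ?q \<le> 2 * B"
    by (rule norm_real_combination_le, rule le) (meson abs_Im_le_cmod order_trans)
  ultimately show ?thesis using norm_triangle_ineq[of ?p "\<i> * ?q"] by (simp add: norm_mult)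
qed

text \<open>The left-hand side is a convex function on the cube \<open>[0, 1]\<^sup>S\<close>, so its maximum is attained at
  a vertex. The offset \<open>d\<close> makes the statement inductive: one coordinate at a time is moved to an
  end point.\<close>

lemma norm_sum_cube_le:
  fixes c :: "'a \<Rightarrow> complex"
  assumes "finite S"
    and "\<And>X. X \<subseteq> S \<Longrightarrow> cmod (d + (\<Sum>i\<in>X. c i)) \<le> B"
    and "\<And>i. i \<in> S \<Longrightarrow> 0 \<le> y i \<and> y i \<le> (1::real)"
  shows "cmod (d + (\<Sum>i\<in>S. c i * of_real (y i))) \<le> B"
  using assms
proof (induction S arbitrary: d rule: finite_induct)
  case empty
  then show ?case by force
next
  case (insert a S)
  let ?s = "\<Sum>i\<in>S. c i * of_real (y i)"
  have y: "0 \<le> y a" "y a \<le> 1" using insert.prems(2) by auto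
  have 0: "cmod (d + ?s) \<le> B"
    using insert.prems by (intro insert.IH) auto
  have 1: "cmod ((d + c a) + ?s) \<le> B"
  proof (rule insert.IH)
    fix X assume X: "X \<subseteq> S"
    then have "finite X" "a \<notin> X" using insert.hyps finite_subset by auto
    then show "cmod (d + c a + (\<Sum>i\<in>X. c i)) \<le> B"
      using insert.prems(1)[of "insert a X"] X by (auto simp: add.assoc)
  qed (use insert.prems in auto)
  have "d + (\<Sum>i\<in>insert a S. c i * of_real (y i)) =
      of_real (1 - y a) * (d + ?s) + of_real (y a) * ((d + c a) + ?s)"
    using insert.hyps by (simp add: algebra_simps)
  also have "cmod \<dots> \<le> (1 - y a) * cmod (d + ?s) + y a * cmod ((d + c a) + ?s)"
    using y by (intro norm_triangle_le) (simp add: norm_mult del: of_real_diff)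
  also have "\<dots> \<le> (1 - y a) * B + y a * B"
    using y 0 1 by (intro add_mono mult_left_mono) auto
  finally show ?case by (simp add: algebra_simps)
qed

lemma norm_sum_box_le:
  fixes c x :: "'a \<Rightarrow> complex"
  assumes S: "finite S" and B: "\<And>X. X \<subseteq> S \<Longrightarrow> cmod (\<Sum>i\<in>X. c i) \<le> B"
    and x: "\<And>i. i \<in> S \<Longrightarrow> cmod (x i) \<le> 1"
  shows "cmod (\<Sum>i\<in>S. c i * x i) \<le> 4 * B"
    and "(\<And>i. i \<in> S \<Longrightarrow> x i \<in> \<real>) \<Longrightarrow> cmod (\<Sum>i\<in>S. c i * x i) \<le> 2 * B"
proof -
  have cube: "cmod (\<Sum>i\<in>S. c i * of_real (y i)) \<le> B"
    if "\<And>i. i \<in> S \<Longrightarrow> 0 \<le> y i \<and> y i \<le> cmod (x i)" for y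
    using norm_sum_cube_le[OF S, of 0 c B y] B that x by (force intro: order_trans)
  show "cmod (\<Sum>i\<in>S. c i * x i) \<le> 4 * B"
    by (rule norm_complex_combination_le) (rule cube)
  assume real: "\<And>i. i \<in> S \<Longrightarrow> x i \<in> \<real>"
  have "cmod (\<Sum>i\<in>S. c i * of_real (Re (x i))) \<le> 2 * B"
    by (rule norm_real_combination_le, rule cube) (meson abs_Re_le_cmod order_trans)
  also have "(\<Sum>i\<in>S. c i * of_real (Re (x i))) = (\<Sum>i\<in>S. c i * x i)"
    using real by (intro sum.cong) (auto simp: of_real_Re)
  finally show "cmod (\<Sum>i\<in>S. c i * x i) \<le> 2 * B" .
qed

text \<open>A bilinear form is bounded one argument at a time: for a fixed set \<open>X\<close> of rows the vector \<open>y\<close> is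
  arbitrary, and the resulting bound for all \<open>X\<close> is what the linear estimate in \<open>x\<close> needs.\<close>

lemma bilinear_form_le_rectangles:
  fixes a :: "'a \<Rightarrow> 'b \<Rightarrow> complex"
  assumes fin: "finite I" "finite J"
    and B: "\<And>X Y. \<lbrakk>X \<subseteq> I; Y \<subseteq> J\<rbrakk> \<Longrightarrow> cmod (\<Sum>i\<in>X. \<Sum>j\<in>Y. a i j) \<le> B"
    and x: "\<And>i. i \<in> I \<Longrightarrow> cmod (x i) \<le> 1" and y: "\<And>j. j \<in> J \<Longrightarrow> cmod (y j) \<le> 1"
  shows "cmod (\<Sum>i\<in>I. x i * (\<Sum>j\<in>J. a i j * y j)) \<le> 16 * B"
    and "\<lbrakk>\<And>i. i \<in> I \<Longrightarrow> x i \<in> \<real>; \<And>j. j \<in> J \<Longrightarrow> y j \<in> \<real>\<rbrakk> \<Longrightarrow>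
      cmod (\<Sum>i\<in>I. x i * (\<Sum>j\<in>J. a i j * y j)) \<le> 4 * B"
proof -
  have swap: "(\<Sum>j\<in>J. (\<Sum>i\<in>X. a i j) * y j) = (\<Sum>i\<in>X. \<Sum>j\<in>J. a i j * y j)" for X
    unfolding sum_distrib_right by (rule sum.swap)
  have cols: "cmod (\<Sum>j\<in>Y. \<Sum>i\<in>X. a i j) \<le> B" if "X \<subseteq> I" "Y \<subseteq> J" for X Y
    using B[OF that] by (subst sum.swap)
  have "cmod (\<Sum>i\<in>X. \<Sum>j\<in>J. a i j * y j) \<le> 4 * B" if "X \<subseteq> I" for X
    using norm_sum_box_le(1)[OF fin(2) cols[OF that], of y] y unfolding swap by simp
  from norm_sum_box_le(1)[OF fin(1) this, of x]
  show "cmod (\<Sum>i\<in>I. x i * (\<Sum>j\<in>J. a i j * y j)) \<le> 16 * B"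
    using x by (simp add: mult.commute)
  assume real: "\<And>i. i \<in> I \<Longrightarrow> x i \<in> \<real>" "\<And>j. j \<in> J \<Longrightarrow> y j \<in> \<real>"
  have "cmod (\<Sum>i\<in>X. \<Sum>j\<in>J. a i j * y j) \<le> 2 * B" if "X \<subseteq> I" for X
    using norm_sum_box_le(2)[OF fin(2) cols[OF that], of y] y real unfolding swap by simp
  from norm_sum_box_le(2)[OF fin(1) this, of x]
  show "cmod (\<Sum>i\<in>I. x i * (\<Sum>j\<in>J. a i j * y j)) \<le> 4 * B"
    using x real by (simp add: mult.commute)
qed

section \<open>The bound by the cut-norm\<close>

text \<open>The spectral radius of \<open>A\<^sup>* A\<close> is at most its largest absolute row sum; the row is that of the
  largest coordinate of an eigenvector.\<close>

lemma sigma1_sq_le_row_sum: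
  assumes A: "A \<in> carrier_mat m n" and n: "1 \<le> n"
  shows "\<exists>j<n. (sigma1 A)\<^sup>2 \<le> (\<Sum>k<n. cmod (\<Sum>i<m. cnj (A $$ (i, j)) * A $$ (i, k)))"
proof -
  obtain v where nz: "\<exists>j<n. v j \<noteq> 0" and
    v: "\<And>j. j < n \<Longrightarrow> (\<Sum>k<n. (\<Sum>i<m. cnj (A $$ (i, j)) * A $$ (i, k)) * v k) =
      complex_of_real ((sigma1 A)\<^sup>2) * v j"
    using sigma1_eigenvector[OF A n] by blast
  obtain j where j: "j < n" and max: "\<And>k. k < n \<Longrightarrow> cmod (v k) \<le> cmod (v j)"
  proof -
    have ne: "(\<lambda>k. cmod (v k)) ` {..<n} \<noteq> {}" using n by (auto simp: lessThan_empty_iff)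
    have "Max ((\<lambda>k. cmod (v k)) ` {..<n}) \<in> (\<lambda>k. cmod (v k)) ` {..<n}"
      by (rule Max_in[OF _ ne]) simp
    then obtain j where j: "j < n" and eq: "cmod (v j) = Max ((\<lambda>k. cmod (v k)) ` {..<n})"
      by (metis (no_types, lifting) imageE lessThan_iff)
    show thesis by (rule that[OF j]) (simp add: eq)
  qed
  have pos: "0 < cmod (v j)"
    using nz max by (metis norm_le_zero_iff not_le order_trans)
  have "(sigma1 A)\<^sup>2 * cmod (v j) = cmod (\<Sum>k<n. (\<Sum>i<m. cnj (A $$ (i, j)) * A $$ (i, k)) * v k)"
    unfolding v[OF j] norm_mult norm_of_real by simp
  also have "\<dots> \<le> (\<Sum>k<n. cmod (\<Sum>i<m. cnj (A $$ (i, j)) * A $$ (i, k)) * cmod (v j))"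
    by (intro sum_norm_le) (simp add: norm_mult max mult_left_mono)
  finally show ?thesis
    using pos j by (auto simp flip: sum_distrib_right)
qed

text \<open>The inequality \<open>cmod e \<le> 1\<close> covers \<open>z = 0\<close>, where \<open>sgn z = 0\<close>.\<close>

lemma cmod_eq_phase_mult:
  obtains e where "cmod e \<le> 1" "z \<in> \<real> \<Longrightarrow> e \<in> \<real>" "complex_of_real (cmod z) = z * e"
proof (rule that)
  show "cmod (cnj (sgn z)) \<le> 1" by (simp add: norm_sgn)
  show "cnj (sgn z) \<in> \<real>" if "z \<in> \<real>" using that by (auto simp: Reals_def sgn_of_real)
  show "complex_of_real (cmod z) = z * cnj (sgn z)"
    by (cases "z = 0") (simp_all add: sgn_eq complex_norm_square[symmetric] power2_eq_square)
qed

lemma sum_norm_eq_combination: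
  fixes f :: "'a \<Rightarrow> complex"
  obtains e where "\<And>k. k \<in> S \<Longrightarrow> cmod (e k) \<le> 1"
    "\<And>k. \<lbrakk>k \<in> S; f k \<in> \<real>\<rbrakk> \<Longrightarrow> e k \<in> \<real>"
    "complex_of_real (\<Sum>k\<in>S. cmod (f k)) = (\<Sum>k\<in>S. f k * e k)"
proof -
  have "\<exists>e. cmod e \<le> 1 \<and> (f k \<in> \<real> \<longrightarrow> e \<in> \<real>) \<and> complex_of_real (cmod (f k)) = f k * e" for k
    using cmod_eq_phase_mult[of "f k"] by metis
  then obtain e where "\<And>k. cmod (e k) \<le> 1" "\<And>k. f k \<in> \<real> \<Longrightarrow> e k \<in> \<real>"
    "\<And>k. complex_of_real (cmod (f k)) = f k * e k"
    by metis
  then show thesis using that[of e] by simp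
qed

text \<open>Here \<open>B\<close> bounds the norm of \<open>A\<close> as an operator from \<open>l\<^sup>\<infinity>\<close> to \<open>l\<^sup>1\<close>, while \<open>max_entry A\<close> is its
  norm from \<open>l\<^sup>1\<close> to \<open>l\<^sup>\<infinity>\<close>, so this is an interpolation inequality. For a real matrix
  the first norm may be taken over real vectors only, which gives the better constant.\<close>

lemma sigma1_sq_le_max_entry_mult:
  assumes A: "A \<in> carrier_mat m n" and m: "1 \<le> m" and n: "1 \<le> n"
    and form: "\<And>x y. \<lbrakk>\<And>i. i < m \<Longrightarrow> cmod (x i) \<le> 1; \<And>j. j < n \<Longrightarrow> cmod (y j) \<le> 1;
        elements_mat A \<subseteq> \<real> \<Longrightarrow> (\<forall>i<m. x i \<in> \<real>) \<and> (\<forall>j<n. y j \<in> \<real>)\<rbrakk> \<Longrightarrow>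
      cmod (\<Sum>i<m. x i * (\<Sum>j<n. A $$ (i, j) * y j)) \<le> B"
  shows "(sigma1 A)\<^sup>2 \<le> max_entry A * B"
proof -
  obtain j where j: "j < n" and
    row: "(sigma1 A)\<^sup>2 \<le> (\<Sum>k<n. cmod (\<Sum>i<m. cnj (A $$ (i, j)) * A $$ (i, k)))"
    using sigma1_sq_le_row_sum[OF A n] by blast
  \<comment> \<open>\<open>g\<close> is row \<open>j\<close> of \<open>A\<^sup>* A\<close>, and \<open>h = A e\<close> for the phases \<open>e\<close> of \<open>g\<close>; both are real if \<open>A\<close> is.\<close>
  define g where "g k = (\<Sum>i<m. cnj (A $$ (i, j)) * A $$ (i, k))" for k
  have A_real: "A $$ (i, k) \<in> \<real>" if "elements_mat A \<subseteq> \<real>" "i < m" "k < n" for i k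
    using that A by auto
  have g_real: "g k \<in> \<real>" if "elements_mat A \<subseteq> \<real>" "k < n" for k
    unfolding g_def using A_real[OF that(1)] that(2) j
    by (intro sum_in_Reals Reals_mult) (auto simp: Reals_cnj_iff)
  obtain e where e: "\<And>k. k < n \<Longrightarrow> cmod (e k) \<le> 1" "\<And>k. \<lbrakk>k < n; g k \<in> \<real>\<rbrakk> \<Longrightarrow> e k \<in> \<real>"
    "complex_of_real (\<Sum>k<n. cmod (g k)) = (\<Sum>k<n. g k * e k)"
    using sum_norm_eq_combination[of "{..<n}" g] by auto
  define h where "h i = (\<Sum>k<n. A $$ (i, k) * e k)" for i
  have h_real: "h i \<in> \<real>" if "elements_mat A \<subseteq> \<real>" "i < m" for i
    unfolding h_def using that A_real e(2) g_real by (intro sum_in_Reals Reals_mult) auto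
  obtain d where d: "\<And>i. i < m \<Longrightarrow> cmod (d i) \<le> 1" "\<And>i. \<lbrakk>i < m; h i \<in> \<real>\<rbrakk> \<Longrightarrow> d i \<in> \<real>"
    "complex_of_real (\<Sum>i<m. cmod (h i)) = (\<Sum>i<m. h i * d i)"
    using sum_norm_eq_combination[of "{..<m}" h] by auto
  have max0: "0 \<le> max_entry A"
    using entry_le_max_entry[OF A _ j, of 0] m by (intro order_trans[OF norm_ge_zero]) auto
  have "(sigma1 A)\<^sup>2 \<le> (\<Sum>k<n. cmod (g k))" using row by (simp add: g_def)
  also have "\<dots> = cmod (\<Sum>k<n. g k * e k)"
    unfolding e(3)[symmetric] norm_of_real by (intro abs_of_nonneg[symmetric] sum_nonneg) simp
  also have "(\<Sum>k<n. g k * e k) = (\<Sum>i<m. cnj (A $$ (i, j)) * h i)"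
    unfolding g_def h_def sum_distrib_left sum_distrib_right
    by (subst sum.swap) (simp add: mult.assoc)
  also have "cmod \<dots> \<le> (\<Sum>i<m. max_entry A * cmod (h i))"
    by (intro sum_norm_le) (simp add: norm_mult entry_le_max_entry[OF A _ j] mult_right_mono)
  also have "\<dots> = max_entry A * cmod (\<Sum>i<m. h i * d i)"
    unfolding d(3)[symmetric] norm_of_real by (simp add: sum_distrib_left sum_nonneg)
  also have "\<dots> \<le> max_entry A * B"
  proof (rule mult_left_mono)
    show "cmod (\<Sum>i<m. h i * d i) \<le> B"
      using form[of d e] d(1,2) e(1,2) g_real h_real unfolding h_def by (simp add: mult.commute)
  qed (rule max0)
  finally show ?thesis .
qed

lemma sigma1_le_cut_norm:
  assumes A: "A \<in> carrier_mat m n" and m: "1 \<le> m" and n: "1 \<le> n"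
  shows "sigma1 A \<le> 4 * sqrt (max_entry A * cut_norm A * real m * real n)"
    and "elements_mat A \<subseteq> \<real> \<Longrightarrow> sigma1 A \<le> 2 * sqrt (max_entry A * cut_norm A * real m * real n)"
proof -
  let ?t = "max_entry A * cut_norm A * real m * real n"
  note rect = rectangle_sum_le_cut_norm[OF A m n]
  note bilin = bilinear_form_le_rectangles[where I = "{..<m}" and J = "{..<n}" and
      a = "\<lambda>i j. A $$ (i, j)" and B = "cut_norm A * real m * real n", OF _ _ rect]
  have "(sigma1 A)\<^sup>2 \<le> max_entry A * (16 * (cut_norm A * real m * real n))"
    by (rule sigma1_sq_le_max_entry_mult[OF A m n]) (use bilin(1) in auto)
  then have "sigma1 A \<le> sqrt (4\<^sup>2 * ?t)" by (intro real_le_rsqrt) (simp add: mult_ac)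
  then show "sigma1 A \<le> 4 * sqrt ?t" by (simp add: real_sqrt_mult)
  assume "elements_mat A \<subseteq> \<real>"
  then have "(sigma1 A)\<^sup>2 \<le> max_entry A * (4 * (cut_norm A * real m * real n))"
    by (intro sigma1_sq_le_max_entry_mult[OF A m n]) (use bilin(2) in auto)
  then have "sigma1 A \<le> sqrt (2\<^sup>2 * ?t)" by (intro real_le_rsqrt) (simp add: mult_ac)
  then show "sigma1 A \<le> 2 * sqrt ?t" by (simp add: real_sqrt_mult)
qed

section \<open>The bound by the box-dot norm\<close>

text \<open>The first bound is used in the upper estimate, the second one for the box-dot norm of the
  witness \<open>1 / \<surd>(ij)\<close>: up to a factor \<open>2\<close> the increments of the square root are \<open>1 / \<surd>k\<close>.\<close>

lemma sqrt_Suc_diff_bounds: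
  "sqrt (real (Suc k)) - sqrt (real k) \<le> 1 / sqrt (real (Suc k))"
  "1 / sqrt (real (Suc k)) \<le> 2 * (sqrt (real (Suc k)) - sqrt (real k))"
proof -
  let ?a = "sqrt (real (Suc k))" and ?b = "sqrt (real k)"
  have a: "0 < ?a" and sq: "?a * ?a = real k + 1" "?b * ?b = real k" by simp_all
  have ab: "?b \<le> ?a" by simp
  have "?b * ?b \<le> ?a * ?b" using ab by (intro mult_right_mono) auto
  then have "(?a - ?b) * ?a \<le> 1" using sq by (simp add: algebra_simps)
  then show "?a - ?b \<le> 1 / ?a" using a by (simp add: pos_le_divide_eq)
  have "0 \<le> (?a - ?b) * (?a - ?b)" by simp
  then have "1 \<le> 2 * (?a - ?b) * ?a" using sq by (simp add: algebra_simps)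
  then show "1 / ?a \<le> 2 * (?a - ?b)" using a by (simp add: pos_divide_le_eq)
qed

lemma sum_sqrt_increments: "(\<Sum>k<n. sqrt (real (Suc k)) - sqrt (real k)) = sqrt (real n)"
  using sum_lessThan_telescope[of "\<lambda>k. sqrt (real k)" n] by simp

definition harmonic :: "nat \<Rightarrow> real" where
  "harmonic n = (\<Sum>k<n. 1 / real (Suc k))"

lemma harmonic_nonneg: "0 \<le> harmonic n"
  unfolding harmonic_def by (intro sum_nonneg) auto

lemma ln_harmonic_bounds:
  "ln (real (Suc n)) \<le> harmonic n"
  "1 \<le> n \<Longrightarrow> harmonic n \<le> 1 + ln (real n)"
proof -
  have ln_step: "1 / real (Suc k) \<le> ln (real (Suc k)) - ln (real k)"
    "ln (real (Suc k)) - ln (real k) \<le> 1 / real k" if "1 \<le> k" for k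
  proof -
    have "ln (real k / real (Suc k)) \<le> real k / real (Suc k) - 1"
      using that by (intro ln_le_minus_one) auto
    also have "\<dots> = - (1 / real (Suc k))" by (simp add: field_simps)
    finally show "1 / real (Suc k) \<le> ln (real (Suc k)) - ln (real k)"
      using that by (simp add: ln_div)
    have "ln (real (Suc k) / real k) \<le> real (Suc k) / real k - 1"
      using that by (intro ln_le_minus_one) auto
    also have "\<dots> = 1 / real k" using that by (simp add: field_simps)
    finally show "ln (real (Suc k)) - ln (real k) \<le> 1 / real k"
      using that by (simp add: ln_div)
  qed
  show "ln (real (Suc n)) \<le> harmonic n"
  proof (induction n)
    case (Suc n)
    then show ?case using ln_step(2)[of "Suc n"] by (simp add: harmonic_def)
  qed (simp add: harmonic_def)
  show "harmonic n \<le> 1 + ln (real n)" if "1 \<le> n"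
    using that
  proof (induction n rule: dec_induct)
    case (step k)
    then show ?case using ln_step(1)[of k] by (simp add: harmonic_def)
  qed (simp add: harmonic_def)
qed

text \<open>Summation by parts along the decreasing rearrangement of \<open>x\<close>, whose positions are given by \<open>r\<close>.
  The induction takes a smallest entry \<open>x a\<close>, puts it last, and subtracts \<open>x a\<close> times the indicator of
  \<open>S\<close>: this costs \<open>x a * B * sqrt (card S)\<close> and leaves a nonnegative vector on \<open>S - {a}\<close>. Since the
  increments of the square root over the remaining positions telescope, lowering all the other entries
  by \<open>x a\<close> gives back \<open>x a * B * sqrt (card S - 1)\<close>.\<close>

lemma combination_le_ranked_sum:
  fixes c :: "'a \<Rightarrow> complex" and x :: "'a \<Rightarrow> real"
  assumes "finite S" "\<And>i. i \<in> S \<Longrightarrow> 0 \<le> x i"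
    and "\<And>X. X \<subseteq> S \<Longrightarrow> cmod (\<Sum>i\<in>X. c i) \<le> B * sqrt (real (card X))"
  shows "\<exists>r. bij_betw r S {..<card S} \<and>
    cmod (\<Sum>i\<in>S. c i * of_real (x i)) \<le>
      B * (\<Sum>i\<in>S. x i * (sqrt (real (Suc (r i))) - sqrt (real (r i))))"
  using assms
proof (induction "card S" arbitrary: S x)
  case 0
  then show ?case by (auto simp: bij_betw_def)
next
  case (Suc k)
  let ?w = "\<lambda>j. sqrt (real (Suc j)) - sqrt (real j)"
  have "S \<noteq> {}" using Suc.hyps(2) by auto
  then obtain a where a: "a \<in> S" and a_min: "\<And>i. i \<in> S \<Longrightarrow> x a \<le> x i"
    using that[OF arg_min_if_finite(1) arg_min_least] Suc.prems(1) by blast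
  define T where "T = S - {a}"
  have S: "S = insert a T" "a \<notin> T" "finite T" and card: "card T = k" "card S = Suc k"
    using a Suc.prems(1) Suc.hyps(2) by (auto simp: T_def)
  have "\<exists>r. bij_betw r T {..<card T} \<and>
    cmod (\<Sum>i\<in>T. c i * of_real (x i - x a)) \<le> B * (\<Sum>i\<in>T. (x i - x a) * ?w (r i))"
    using Suc.prems(3) a_min S by (intro Suc.hyps(1)) (auto simp: card)
  then obtain r where r: "bij_betw r T {..<k}"
    and le: "cmod (\<Sum>i\<in>T. c i * of_real (x i - x a)) \<le> B * (\<Sum>i\<in>T. (x i - x a) * ?w (r i))"
    unfolding card by blast
  define r' where "r' = r(a := k)"
  have r'T: "r' i = r i" if "i \<in> T" for i using that S(2) by (auto simp: r'_def)
  have r'a: "r' a = k" by (simp add: r'_def)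
  have "bij_betw r' S {..<card S}"
  proof -
    have "bij_betw r' T {..<k}" using r r'T by (simp cong: bij_betw_cong)
    then have "bij_betw r' (T \<union> {a}) ({..<k} \<union> {k})"
      using notIn_Un_bij_betw[of a T r' "{..<k}"] S(2) r'a by simp
    then show ?thesis by (simp add: S(1) card(2)[unfolded S(1)] lessThan_Suc)
  qed
  moreover have "cmod (\<Sum>i\<in>S. c i * of_real (x i)) \<le> B * (\<Sum>i\<in>S. x i * ?w (r' i))"
  proof -
    have "(\<Sum>i\<in>S. c i * of_real (x i)) =
        of_real (x a) * (\<Sum>i\<in>S. c i) + (\<Sum>i\<in>T. c i * of_real (x i - x a))"
      using S by (simp add: algebra_simps sum_subtractf sum_distrib_left sum_distrib_right)
    then have "cmod (\<Sum>i\<in>S. c i * of_real (x i)) \<le>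
        x a * cmod (\<Sum>i\<in>S. c i) + cmod (\<Sum>i\<in>T. c i * of_real (x i - x a))"
      using Suc.prems(2)[OF a] by (metis norm_triangle_ineq norm_mult norm_of_real abs_of_nonneg)
    also have "\<dots> \<le> x a * (B * sqrt (real (Suc k))) + B * (\<Sum>i\<in>T. (x i - x a) * ?w (r i))"
      using Suc.prems(2)[OF a] Suc.prems(3)[OF order_refl] le card
      by (intro add_mono mult_left_mono) auto
    also have "(\<Sum>i\<in>T. (x i - x a) * ?w (r i)) = (\<Sum>i\<in>T. x i * ?w (r i)) - x a * (\<Sum>i\<in>T. ?w (r i))"
      unfolding sum_distrib_left sum_subtractf[symmetric]
      by (intro sum.cong refl) (rule left_diff_distrib)
    also have "(\<Sum>i\<in>T. ?w (r i)) = sqrt (real k)"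
      using sum.reindex_bij_betw[OF r, of ?w] sum_sqrt_increments[of k] by simp
    also have "x a * (B * sqrt (real (Suc k))) + B * ((\<Sum>i\<in>T. x i * ?w (r i)) - x a * sqrt (real k)) =
        B * (x a * ?w k + (\<Sum>i\<in>T. x i * ?w (r i)))"
      by (simp add: algebra_simps)
    also have "x a * ?w k + (\<Sum>i\<in>T. x i * ?w (r i)) = (\<Sum>i\<in>S. x i * ?w (r' i))"
      using S r'T r'a by simp
    finally show ?thesis .
  qed
  ultimately show ?case by blast
qed

text \<open>By Cauchy-Schwarz, \<open>\<Sum> y / \<surd>l \<le> \<parallel>y\<parallel> \<surd>(\<Sum> 1 / l)\<close>, where the last sum no longer depends on the
  order of the entries.\<close>

lemma norm_combination_le_harmonic:
  fixes c x :: "'a \<Rightarrow> complex"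
  assumes S: "finite S"
    and c: "\<And>X. X \<subseteq> S \<Longrightarrow> cmod (\<Sum>i\<in>X. c i) \<le> B * sqrt (real (card X))" and B: "0 \<le> B"
  shows "cmod (\<Sum>i\<in>S. c i * x i) \<le> 4 * (B * sqrt (harmonic (card S)) * sqrt (\<Sum>i\<in>S. (cmod (x i))\<^sup>2))"
proof (rule norm_complex_combination_le)
  fix y assume y: "\<And>i. i \<in> S \<Longrightarrow> 0 \<le> y i \<and> y i \<le> cmod (x i)"
  then obtain r where r: "bij_betw r S {..<card S}" and
    le: "cmod (\<Sum>i\<in>S. c i * of_real (y i)) \<le>
      B * (\<Sum>i\<in>S. y i * (sqrt (real (Suc (r i))) - sqrt (real (r i))))"
    using combination_le_ranked_sum[OF S _ c, of y] by blast
  have "(\<Sum>i\<in>S. y i * (sqrt (real (Suc (r i))) - sqrt (real (r i)))) \<le>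
      (\<Sum>i\<in>S. y i * (1 / sqrt (real (Suc (r i)))))"
    using y by (intro sum_mono mult_left_mono sqrt_Suc_diff_bounds(1)) auto
  also have "\<dots> \<le> sqrt (\<Sum>i\<in>S. (y i)\<^sup>2) * sqrt (\<Sum>i\<in>S. (1 / sqrt (real (Suc (r i))))\<^sup>2)"
    using y L2_set_mult_ineq[of y "\<lambda>i. 1 / sqrt (real (Suc (r i)))" S]
    by (simp add: L2_set_def)
  also have "(\<Sum>i\<in>S. (1 / sqrt (real (Suc (r i))))\<^sup>2) = (\<Sum>i\<in>S. 1 / real (Suc (r i)))"
    by (intro sum.cong refl) (simp add: power_divide)
  also have "\<dots> = harmonic (card S)"
    unfolding harmonic_def by (rule sum.reindex_bij_betw[OF r])
  also have "sqrt (\<Sum>i\<in>S. (y i)\<^sup>2) * sqrt (harmonic (card S)) \<le>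
      sqrt (\<Sum>i\<in>S. (cmod (x i))\<^sup>2) * sqrt (harmonic (card S))"
    using y by (intro mult_right_mono real_sqrt_le_mono sum_mono power_mono) (auto simp: harmonic_nonneg)
  finally show "cmod (\<Sum>i\<in>S. c i * of_real (y i)) \<le>
      B * sqrt (harmonic (card S)) * sqrt (\<Sum>i\<in>S. (cmod (x i))\<^sup>2)"
    using mult_left_mono[OF _ B] le by (fastforce simp: mult_ac)
qed

text \<open>The quantities \<open>P = \<parallel>A v\<parallel>\<^sup>2\<close> and \<open>Q = \<parallel>v\<parallel>\<^sup>2\<close> satisfy \<open>P = \<sigma>\<^sup>2 Q\<close>. The linear estimate in \<open>A v\<close>
  bounds the column sums of the form, and the one in \<open>v\<close> then shows that \<open>P \<le> K \<surd>P \<surd>Q\<close>; hence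
  \<open>\<sigma> \<le> K\<close>.\<close>

lemma sigma1_le_boxdot_norm_harmonic:
  assumes A: "A \<in> carrier_mat m n" and m: "1 \<le> m" and n: "1 \<le> n"
  shows "sigma1 A \<le> 16 * boxdot_norm A * sqrt (harmonic m) * sqrt (harmonic n)"
proof -
  let ?K = "16 * boxdot_norm A * sqrt (harmonic m) * sqrt (harmonic n)"
  obtain v where s0: "0 \<le> sigma1 A" and nz: "\<exists>j<n. v j \<noteq> 0" and
    v: "\<And>j. j < n \<Longrightarrow> (\<Sum>k<n. (\<Sum>i<m. cnj (A $$ (i, j)) * A $$ (i, k)) * v k) =
      complex_of_real ((sigma1 A)\<^sup>2) * v j"
    using sigma1_eigenvector[OF A n] by blast
  define u where "u i = (\<Sum>k<n. A $$ (i, k) * v k)" for i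
  define P Q where "P = (\<Sum>i<m. (cmod (u i))\<^sup>2)" and "Q = (\<Sum>j<n. (cmod (v j))\<^sup>2)"
  have Q: "0 < Q" unfolding Q_def using nz by (auto intro!: sum_pos2)
  have P0: "0 \<le> P" unfolding P_def by (intro sum_nonneg) auto
  have "complex_of_real P = complex_of_real ((sigma1 A)\<^sup>2) * complex_of_real Q"
    unfolding P_def Q_def u_def by (rule norm_sq_image_eigenvector[OF v])
  then have P: "P = (sigma1 A)\<^sup>2 * Q" unfolding of_real_mult[symmetric] of_real_eq_iff .
  have box0: "0 \<le> boxdot_norm A"
    using rectangle_sum_le_boxdot_norm[OF A, of "{0}" "{0}"] m n
    by (auto intro: order_trans[OF norm_ge_zero])
  define N where "N = boxdot_norm A * sqrt (harmonic m) * sqrt P"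
  have N0: "0 \<le> N" unfolding N_def using box0 P0 by (simp add: harmonic_nonneg)
  have cols: "cmod (\<Sum>j\<in>Y. \<Sum>i<m. A $$ (i, j) * cnj (u i)) \<le> 4 * N * sqrt (real (card Y))"
    if Y: "Y \<subseteq> {..<n}" for Y
  proof -
    have "cmod (\<Sum>i\<in>X. \<Sum>j\<in>Y. A $$ (i, j)) \<le>
        (boxdot_norm A * sqrt (real (card Y))) * sqrt (real (card X))" if "X \<subseteq> {..<m}" for X
      using rectangle_sum_le_boxdot_norm[OF A that Y] by (simp add: mult_ac)
    then have "cmod (\<Sum>i<m. (\<Sum>j\<in>Y. A $$ (i, j)) * cnj (u i)) \<le>
        4 * (boxdot_norm A * sqrt (real (card Y)) * sqrt (harmonic (card {..<m})) *
          sqrt (\<Sum>i<m. (cmod (cnj (u i)))\<^sup>2))"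
      using box0 by (intro norm_combination_le_harmonic) auto
    also have "(\<Sum>i<m. (\<Sum>j\<in>Y. A $$ (i, j)) * cnj (u i)) =
        (\<Sum>j\<in>Y. \<Sum>i<m. A $$ (i, j) * cnj (u i))"
      unfolding sum_distrib_right by (rule sum.swap)
    finally show ?thesis by (simp add: N_def P_def mult_ac)
  qed
  have "complex_of_real P = (\<Sum>i<m. cnj (u i) * (\<Sum>j<n. A $$ (i, j) * v j))"
    unfolding P_def of_real_sum complex_norm_square u_def by (simp only: mult.commute)
  also have "\<dots> = (\<Sum>j<n. (\<Sum>i<m. A $$ (i, j) * cnj (u i)) * v j)"
    unfolding sum_distrib_left sum_distrib_right by (subst sum.swap) (simp only: mult_ac)
  finally have "P = cmod (\<Sum>j<n. (\<Sum>i<m. A $$ (i, j) * cnj (u i)) * v j)"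
    using P0 by (metis norm_of_real abs_of_nonneg)
  also have "\<dots> \<le> 4 * (4 * N * sqrt (harmonic (card {..<n})) * sqrt (\<Sum>j<n. (cmod (v j))\<^sup>2))"
    using N0 by (intro norm_combination_le_harmonic cols) auto
  also have "\<dots> = ?K * (sqrt P * sqrt Q)" unfolding N_def Q_def by simp
  also have "sqrt P * sqrt Q = sigma1 A * Q"
    using s0 Q by (simp add: P real_sqrt_mult)
  finally have "sigma1 A * (sigma1 A * Q) \<le> ?K * (sigma1 A * Q)"
    using P s0 Q by (simp add: power2_eq_square real_sqrt_mult mult_ac)
  moreover have "0 \<le> ?K" using box0 by (simp add: harmonic_nonneg)
  ultimately show ?thesis
    using s0 Q by (cases "sigma1 A = 0") (auto simp: mult_le_cancel_right)
qed

text \<open>The factor \<open>3\<close> comes from \<open>1 \<le> 2 ln 2 \<le> 2 ln k\<close>, which absorbs the constant in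
  \<open>H\<^sub>k \<le> 1 + ln k\<close>.\<close>

lemma sigma1_le_boxdot_norm:
  assumes A: "A \<in> carrier_mat m n" and m: "2 \<le> m" and n: "2 \<le> n"
  shows "sigma1 A \<le> 48 * boxdot_norm A * sqrt (ln (real m) * ln (real n))"
proof -
  have harmonic: "harmonic k \<le> 3 * ln (real k)" if "2 \<le> k" for k
  proof -
    have "ln (1 / 2) \<le> 1 / 2 - (1::real)" by (rule ln_le_minus_one) simp
    then have "1 / 2 \<le> ln (2::real)" by (simp add: ln_div)
    also have "\<dots> \<le> ln (real k)" using that by simp
    finally show ?thesis using ln_harmonic_bounds(2)[of k] that by simp
  qed
  have box0: "0 \<le> boxdot_norm A"
    using rectangle_sum_le_boxdot_norm[OF A, of "{0}" "{0}"] m n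
    by (auto intro: order_trans[OF norm_ge_zero])
  have "sigma1 A \<le> 16 * boxdot_norm A * (sqrt (harmonic m) * sqrt (harmonic n))"
    using sigma1_le_boxdot_norm_harmonic[OF A] m n by (simp add: mult.assoc)
  also have "\<dots> \<le> 16 * boxdot_norm A * (sqrt (3 * ln (real m)) * sqrt (3 * ln (real n)))"
    using box0 m n harmonic by (intro mult_left_mono mult_mono real_sqrt_le_mono) (auto simp: harmonic_nonneg)
  also have "sqrt (3 * ln (real m)) * sqrt (3 * ln (real n)) = 3 * sqrt (ln (real m) * ln (real n))"
    by (simp add: real_sqrt_mult)
  finally show ?thesis by simp
qed

section \<open>Matrices attaining the bounds up to a constant\<close>

lemma all_ones_cut_norm_sharp:
  assumes m: "1 \<le> m" and n: "1 \<le> n"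
  defines "J \<equiv> mat m n (\<lambda>_. 1 :: complex)"
  shows "elements_mat J \<subseteq> \<real>" "J \<noteq> 0\<^sub>m m n"
    "sqrt (max_entry J * cut_norm J * real m * real n) \<le> sigma1 J"
proof -
  have J: "J \<in> carrier_mat m n" by (simp add: J_def)
  have el: "elements_mat J = {1}"
  proof
    show "elements_mat J \<subseteq> {1}" by (auto simp: J_def)
    have "J $$ (0, 0) = 1" using m n by (simp add: J_def)
    then show "{1} \<subseteq> elements_mat J" using elements_matI[OF J, of 0 0] m n by auto
  qed
  then show "elements_mat J \<subseteq> \<real>" by simp
  show "J \<noteq> 0\<^sub>m m n"
  proof
    assume "J = 0\<^sub>m m n"
    then have "J $$ (0, 0) = 0\<^sub>m m n $$ (0, 0)" by simp
    then show False using m n by (simp add: J_def)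
  qed
  have "cut_norm J \<le> 1"
  proof (rule cut_norm_leI[OF J m n])
    fix X Y assume X: "X \<subseteq> {..<m}" and Y: "Y \<subseteq> {..<n}"
    have "(\<Sum>i\<in>X. \<Sum>j\<in>Y. J $$ (i, j)) = (\<Sum>i\<in>X. \<Sum>j\<in>Y. 1)"
      using X Y by (intro sum.cong refl) (auto simp: J_def subset_iff)
    also have "cmod \<dots> = real (card X) * real (card Y)" by (simp add: norm_mult)
    also have "\<dots> \<le> real m * real n"
      using card_mono[OF _ X] card_mono[OF _ Y] by (intro mult_mono) auto
    finally show "cmod (\<Sum>i\<in>X. \<Sum>j\<in>Y. J $$ (i, j)) \<le> 1 * real m * real n" by simp
  qed
  then have "max_entry J * cut_norm J * real m * real n \<le> real m * real n"
    using mult_right_mono[of "cut_norm J" 1 "real m * real n"]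
    by (simp add: max_entry_def el mult.assoc)
  moreover have "sqrt (real m * real n) \<le> sigma1 J"
    using sigma1_rank_one_ge[of n "\<lambda>_. 1" "\<lambda>_. 1" m] n
    by (auto simp: J_def case_prod_unfold Suc_le_eq)
  ultimately show "sqrt (max_entry J * cut_norm J * real m * real n) \<le> sigma1 J"
    by (meson order_trans real_sqrt_le_mono)
qed

text \<open>Among the sets of a given size the initial segment maximises the sum. Inserting the elements in
  increasing order makes this precise: an element \<open>b\<close> above all of \<open>X\<close> is at least \<open>card X\<close>.\<close>

lemma sum_inverse_sqrt_le:
  assumes "finite X"
  shows "(\<Sum>i\<in>X. 1 / sqrt (real (Suc i))) \<le> 2 * sqrt (real (card X))"
  using assms
proof (induction X rule: finite_linorder_max_induct)
  case empty
  then show ?case by simp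
next
  case (insert b X)
  have "card X \<le> b" using card_mono[of "{..<b}" X] insert.hyps by auto
  then have "1 / sqrt (real (Suc b)) \<le> 1 / sqrt (real (Suc (card X)))"
    by (intro divide_left_mono) auto
  also have "\<dots> \<le> 2 * (sqrt (real (Suc (card X))) - sqrt (real (card X)))"
    by (rule sqrt_Suc_diff_bounds(2))
  moreover have "b \<notin> X" using insert.hyps by blast
  ultimately show ?case using insert by simp
qed

lemma inverse_sqrt_matrix_boxdot_norm_sharp:
  assumes m: "1 \<le> m" and n: "1 \<le> n"
  defines "D \<equiv> mat m n (\<lambda>(i, j). complex_of_real (1 / sqrt (real (Suc i)) * (1 / sqrt (real (Suc j)))))"
  shows "D \<noteq> 0\<^sub>m m n" "boxdot_norm D * sqrt (ln (real m) * ln (real n)) \<le> 4 * sigma1 D"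
proof -
  have D: "D \<in> carrier_mat m n" by (simp add: D_def)
  show "D \<noteq> 0\<^sub>m m n"
  proof
    assume "D = 0\<^sub>m m n"
    then have "D $$ (0, 0) = 0\<^sub>m m n $$ (0, 0)" by simp
    then show False using m n by (simp add: D_def)
  qed
  have box: "boxdot_norm D \<le> 4"
  proof (rule boxdot_norm_leI[OF D m n])
    fix X Y assume X: "X \<subseteq> {..<m}" and Y: "Y \<subseteq> {..<n}"
    let ?p = "\<Sum>i\<in>X. 1 / sqrt (real (Suc i))" and ?q = "\<Sum>j\<in>Y. 1 / sqrt (real (Suc j))"
    have fin: "finite X" "finite Y" using X Y finite_subset by blast+
    have "(\<Sum>i\<in>X. \<Sum>j\<in>Y. D $$ (i, j)) = (\<Sum>i\<in>X. \<Sum>j\<in>Y.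
        complex_of_real (1 / sqrt (real (Suc i)) * (1 / sqrt (real (Suc j)))))"
    proof (intro sum.cong refl)
      fix i j assume "i \<in> X" "j \<in> Y"
      then show "D $$ (i, j) = complex_of_real (1 / sqrt (real (Suc i)) * (1 / sqrt (real (Suc j))))"
        using X Y unfolding D_def by (subst index_mat(1)) auto
    qed
    also have "\<dots> = complex_of_real (?p * ?q)" unfolding sum_product of_real_sum by (rule refl)
    also have "cmod \<dots> = ?p * ?q"
      unfolding norm_of_real by (intro abs_of_nonneg mult_nonneg_nonneg sum_nonneg) auto
    also have "\<dots> \<le> (2 * sqrt (real (card X))) * (2 * sqrt (real (card Y)))"
      using fin by (intro mult_mono sum_inverse_sqrt_le sum_nonneg) auto
    finally show "cmod (\<Sum>i\<in>X. \<Sum>j\<in>Y. D $$ (i, j)) \<le> 4 * sqrt (real (card X)) * sqrt (real (card Y))"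
      by simp
  qed
  have ln_harmonic: "ln (real k) \<le> harmonic k" if "1 \<le> k" for k
    using ln_harmonic_bounds(1)[of k] that by (auto intro: order_trans[of _ "ln (real (Suc k))"])
  have sq: "(\<Sum>i<k. (1 / sqrt (real (Suc i)))\<^sup>2) = harmonic k" for k
    unfolding harmonic_def by (intro sum.cong refl) (simp add: power_divide)
  have "sqrt (harmonic m * harmonic n) \<le> sigma1 D"
    unfolding D_def sq[symmetric]
    by (rule sigma1_rank_one_ge) (use n in \<open>auto simp: Suc_le_eq\<close>)
  moreover have "sqrt (ln (real m) * ln (real n)) \<le> sqrt (harmonic m * harmonic n)"
    using m n ln_harmonic by (intro real_sqrt_le_mono mult_mono) (auto simp: harmonic_nonneg)
  ultimately have "sqrt (ln (real m) * ln (real n)) \<le> sigma1 D" by (rule order_trans[rotated])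
  then show "boxdot_norm D * sqrt (ln (real m) * ln (real n)) \<le> 4 * sigma1 D"
    using box m n by (intro mult_mono) auto
qed

theorem theorem3:
  shows
    "(\<forall>m n (A :: complex mat). 1 \<le> m \<longrightarrow> 1 \<le> n \<longrightarrow> A \<in> carrier_mat m n \<longrightarrow> elements_mat A \<subseteq> \<real> \<longrightarrow>
        sigma1 A \<le> 2 * sqrt (max_entry A * cut_norm A * real m * real n)) \<and>
     (\<forall>m n (A :: complex mat). 1 \<le> m \<longrightarrow> 1 \<le> n \<longrightarrow> A \<in> carrier_mat m n \<longrightarrow>
        sigma1 A \<le> 4 * sqrt (max_entry A * cut_norm A * real m * real n)) \<and>
     (\<exists>C::real. 0 < C \<and> C < 10 ^ 5 \<and>
        (\<forall>m n (A :: complex mat). 2 \<le> m \<longrightarrow> 2 \<le> n \<longrightarrow> A \<in> carrier_mat m n \<longrightarrow>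
           sigma1 A \<le> C * boxdot_norm A * sqrt (ln (real m) * ln (real n)))) \<and>
     (\<exists>c::real. 0 < c \<and>
        (\<forall>m n. 1 \<le> m \<longrightarrow> 1 \<le> n \<longrightarrow>
           (\<exists>A :: complex mat. A \<in> carrier_mat m n \<and> elements_mat A \<subseteq> \<real> \<and> A \<noteq> 0\<^sub>m m n \<and>
              c * sqrt (max_entry A * cut_norm A * real m * real n) \<le> sigma1 A))) \<and>
     (\<exists>c::real. 0 < c \<and>
        (\<forall>m n. 1 \<le> m \<longrightarrow> 1 \<le> n \<longrightarrow>
           (\<exists>A :: complex mat. A \<in> carrier_mat m n \<and> A \<noteq> 0\<^sub>m m n \<and>
              c * sqrt (max_entry A * cut_norm A * real m * real n) \<le> sigma1 A))) \<and>
     (\<exists>c::real. 0 < c \<and>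
        (\<forall>m n. 2 \<le> m \<longrightarrow> 2 \<le> n \<longrightarrow>
           (\<exists>A :: complex mat. A \<in> carrier_mat m n \<and> A \<noteq> 0\<^sub>m m n \<and>
              c * (boxdot_norm A * sqrt (ln (real m) * ln (real n))) \<le> sigma1 A)))"
proof (intro conjI)
  show "\<forall>m n (A :: complex mat). 1 \<le> m \<longrightarrow> 1 \<le> n \<longrightarrow> A \<in> carrier_mat m n \<longrightarrow> elements_mat A \<subseteq> \<real> \<longrightarrow>
        sigma1 A \<le> 2 * sqrt (max_entry A * cut_norm A * real m * real n)"
    using sigma1_le_cut_norm(2) by blast
  show "\<forall>m n (A :: complex mat). 1 \<le> m \<longrightarrow> 1 \<le> n \<longrightarrow> A \<in> carrier_mat m n \<longrightarrow>
        sigma1 A \<le> 4 * sqrt (max_entry A * cut_norm A * real m * real n)"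
    using sigma1_le_cut_norm(1) by blast
  show "\<exists>C::real. 0 < C \<and> C < 10 ^ 5 \<and>
        (\<forall>m n (A :: complex mat). 2 \<le> m \<longrightarrow> 2 \<le> n \<longrightarrow> A \<in> carrier_mat m n \<longrightarrow>
           sigma1 A \<le> C * boxdot_norm A * sqrt (ln (real m) * ln (real n)))"
    using sigma1_le_boxdot_norm by (intro exI[of _ 48]) auto
  have ones: "\<exists>A :: complex mat. A \<in> carrier_mat m n \<and> elements_mat A \<subseteq> \<real> \<and> A \<noteq> 0\<^sub>m m n \<and>
      1 * sqrt (max_entry A * cut_norm A * real m * real n) \<le> sigma1 A"
    if "1 \<le> m" "1 \<le> n" for m n
    using all_ones_cut_norm_sharp[OF that] by (intro exI[of _ "mat m n (\<lambda>_. 1)"]) simp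
  show "\<exists>c::real. 0 < c \<and>
        (\<forall>m n. 1 \<le> m \<longrightarrow> 1 \<le> n \<longrightarrow>
           (\<exists>A :: complex mat. A \<in> carrier_mat m n \<and> elements_mat A \<subseteq> \<real> \<and> A \<noteq> 0\<^sub>m m n \<and>
              c * sqrt (max_entry A * cut_norm A * real m * real n) \<le> sigma1 A))"
    by (intro exI[of _ 1] conjI allI impI ones) simp_all
  show "\<exists>c::real. 0 < c \<and>
        (\<forall>m n. 1 \<le> m \<longrightarrow> 1 \<le> n \<longrightarrow>
           (\<exists>A :: complex mat. A \<in> carrier_mat m n \<and> A \<noteq> 0\<^sub>m m n \<and>
              c * sqrt (max_entry A * cut_norm A * real m * real n) \<le> sigma1 A))"
  proof (intro exI[of _ 1] conjI allI impI)
    fix m n :: nat assume "1 \<le> m" "1 \<le> n"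
    then show "\<exists>A :: complex mat. A \<in> carrier_mat m n \<and> A \<noteq> 0\<^sub>m m n \<and>
        1 * sqrt (max_entry A * cut_norm A * real m * real n) \<le> sigma1 A"
      using ones[of m n] by blast
  qed simp
  show "\<exists>c::real. 0 < c \<and>
        (\<forall>m n. 2 \<le> m \<longrightarrow> 2 \<le> n \<longrightarrow>
           (\<exists>A :: complex mat. A \<in> carrier_mat m n \<and> A \<noteq> 0\<^sub>m m n \<and>
              c * (boxdot_norm A * sqrt (ln (real m) * ln (real n))) \<le> sigma1 A))"
  proof (intro exI[of _ "1 / 4"] conjI allI impI)
    fix m n :: nat assume "2 \<le> m" "2 \<le> n"
    then show "\<exists>A :: complex mat. A \<in> carrier_mat m n \<and> A \<noteq> 0\<^sub>m m n \<and>
        1 / 4 * (boxdot_norm A * sqrt (ln (real m) * ln (real n))) \<le> sigma1 A"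
      using inverse_sqrt_matrix_boxdot_norm_sharp[of m n]
      by (intro exI[of _ "mat m n (\<lambda>(i, j). complex_of_real (1 / sqrt (real (Suc i)) * (1 / sqrt (real (Suc j)))))"])
        simp
  qed simp
qed

end
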